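(* Let $a\in L^1(I)$ and suppose that the periodic problem on $J$ with potential $\tilde a$ is nonresonant and $G_P[\tilde a,2T]<0$ on $J\times J$. Let $\sigma_1,\sigma_2\in L^1(I)$, let $u_N$ be the unique solution of the Neumann problem $u''+a(t)u=\sigma_1(t)$ a.e. on $I$, $u'(0)=u'(T)=0$, and let $u_D$ be the unique solution of the Dirichlet problem $u''+a(t)u=\sigma_2(t)$ a.e. on $I$, $u(0)=u(T)=0$. 1. If $0\le\sigma_2(t)\le\sigma_1(t)$ for a.e. $t\in I$, then $u_N(t)\le u_D(t)\le 0$ for all $t\in I$. 2. If $0\ge\sigma_2(t)\ge\sigma_1(t)$ for a.e. $t\in I$, then $u_N(t)\ge u_D(t)\ge 0$ for all $t\in I$.
   Context: Fix $T>0$ and put $I=[0,T]$, $J=[0,2T]$. Solutions are functions $u\in C^1$ with $u'$ absolutely continuous on the interval in question. $\tilde a$ is the even extension of $a$ to $J$: $\tilde a(t)=a(t)$ on $[0,T]$, $\tilde a(t)=a(2T-t)$ on $(T,2T]$. The periodic problem on $J$ is $u''+\tilde a(t)u=\tilde\sigma(t)$ a.e. on $J$, $u(0)=u(2T)$, $u'(0)=u'(2T)$; it is nonresonant if for $\tilde\sigma=0$ it has only the trivial solution, and then $G_P[\tilde a,2T]$ is its Green's function: the continuous function on $J\times J$ such that for each $\tilde\sigma\in L^1(J)$ the unique solution is $u(t)=\int_0^{2T}G_P[\tilde a,2T](t,s)\tilde\sigma(s)\,ds$. (If this problem is nonresonant, the Neumann and Dirichlet problems on $I$ with potential $a$ are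 uniquely solvable too.) *)

theory Defs
  imports "HOL-Analysis.Analysis"
begin

text \<open>Absolute continuity of a real function in the usual epsilon-delta sense. A set \<open>D\<close> with
  \<open>D division_of \<Union>D\<close> is a finite family of nonempty compact intervals \<open>k = {Inf k..Sup k}\<close> with
  pairwise disjoint interiors. The library constant
  \<open>absolutely_continuous\<close> is the unrelated notion for measures.\<close>

definition abs_cont_on :: "real set \<Rightarrow> (real \<Rightarrow> real) \<Rightarrow> bool" where
  "abs_cont_on S f \<longleftrightarrow>
     (\<forall>\<epsilon>>0. \<exists>\<delta>>0. \<forall>D. D division_of \<Union>D \<and> \<Union>D \<subseteq> S \<and> (\<Sum>k\<in>D. Sup k - Inf k) < \<delta> \<longrightarrow>
        (\<Sum>k\<in>D. \<bar>f (Sup k) - f (Inf k)\<bar>) < \<epsilon>)"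

text \<open>\<open>u\<close> is a solution of \<open>u'' + b u = \<sigma>\<close> almost everywhere on \<open>[0,L]\<close>, of class \<open>C\<^sup>1\<close> with
  absolutely continuous derivative \<open>u' = v\<close>. Derivatives at the endpoints are one-sided, and
  values outside \<open>[0,L]\<close> are irrelevant. For \<open>L > 0\<close> the function \<open>v\<close> is determined by \<open>u\<close> on
  \<open>[0,L]\<close>; it is an explicit argument so that boundary conditions can refer to it.\<close>

definition is_solution ::
  "real \<Rightarrow> (real \<Rightarrow> real) \<Rightarrow> (real \<Rightarrow> real) \<Rightarrow> (real \<Rightarrow> real) \<Rightarrow> (real \<Rightarrow> real) \<Rightarrow> bool" where
  "is_solution L b \<sigma> u v \<longleftrightarrow>
     (\<forall>t\<in>{0..L}. (u has_real_derivative v t) (at t within {0..L})) \<and>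
     continuous_on {0..L} v \<and>
     abs_cont_on {0..L} v \<and>
     (AE t in lebesgue_on {0..L}.
        \<exists>w. (v has_real_derivative w) (at t within {0..L}) \<and> w + b t * u t = \<sigma> t)"

definition periodic_solution ::
  "real \<Rightarrow> (real \<Rightarrow> real) \<Rightarrow> (real \<Rightarrow> real) \<Rightarrow> (real \<Rightarrow> real) \<Rightarrow> bool" where
  "periodic_solution L b \<sigma> u \<longleftrightarrow> (\<exists>v. is_solution L b \<sigma> u v \<and> u 0 = u L \<and> v 0 = v L)"

definition neumann_solution ::
  "real \<Rightarrow> (real \<Rightarrow> real) \<Rightarrow> (real \<Rightarrow> real) \<Rightarrow> (real \<Rightarrow> real) \<Rightarrow> bool" where
  "neumann_solution L b \<sigma> u \<longleftrightarrow> (\<exists>v. is_solution L b \<sigma> u v \<and> v 0 = 0 \<and> v L = 0)"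

definition dirichlet_solution ::
  "real \<Rightarrow> (real \<Rightarrow> real) \<Rightarrow> (real \<Rightarrow> real) \<Rightarrow> (real \<Rightarrow> real) \<Rightarrow> bool" where
  "dirichlet_solution L b \<sigma> u \<longleftrightarrow> (\<exists>v. is_solution L b \<sigma> u v \<and> u 0 = 0 \<and> u L = 0)"

definition periodic_nonresonant :: "real \<Rightarrow> (real \<Rightarrow> real) \<Rightarrow> bool" where
  "periodic_nonresonant L b \<longleftrightarrow>
     (\<forall>u. periodic_solution L b (\<lambda>t. 0) u \<longrightarrow> (\<forall>t\<in>{0..L}. u t = 0))"

text \<open>\<open>G\<close> is the Green's function of the periodic problem on \<open>[0,L]\<close> with potential \<open>b\<close>. By
  continuity its values on \<open>[0,L] \<times> [0,L]\<close> are uniquely determined; those outside are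
  irrelevant. Note that \<open>absolutely_integrable_on\<close> is Lebesgue integrability, so
  \<open>\<sigma>\<close> ranges over \<open>L\<^sup>1\<close>.\<close>

definition periodic_greens_function ::
  "real \<Rightarrow> (real \<Rightarrow> real) \<Rightarrow> (real \<Rightarrow> real \<Rightarrow> real) \<Rightarrow> bool" where
  "periodic_greens_function L b G \<longleftrightarrow>
     continuous_on ({0..L} \<times> {0..L}) (\<lambda>(t, s). G t s) \<and>
     (\<forall>\<sigma>. \<sigma> absolutely_integrable_on {0..L} \<longrightarrow>
        periodic_solution L b \<sigma> (\<lambda>t. LINT s:{0..L}|lebesgue. G t s * \<sigma> s) \<and>
        (\<forall>u. periodic_solution L b \<sigma> u \<longrightarrow>
           (\<forall>t\<in>{0..L}. u t = (LINT s:{0..L}|lebesgue. G t s * \<sigma> s))))"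

definition even_extension :: "real \<Rightarrow> (real \<Rightarrow> real) \<Rightarrow> real \<Rightarrow> real" where
  "even_extension T f t = (if t \<le> T then f t else f (2 * T - t))"

end

theory Submission
  imports Defs
begin

text \<open>The sign of the periodic Green's function is used through a single function. Integrating \<open>G\<close>
  against \<open>1\<close> and symmetrising about \<open>T\<close> yields a function \<open>w > 0\<close> on \<open>[0,T]\<close> with \<open>w'' + a w = -2\<close> and
  \<open>w'(0) = w'(T) = 0\<close> (lemma \<open>neumann_supersolution\<close>). A positive strict supersolution forces a maximum
  principle for \<open>u'' + a u = \<sigma> \<ge> 0\<close>: where \<open>u > 0\<close>, the function \<open>u' w - u w'\<close> has the derivative
  \<open>\<sigma> w + 2 u > 0\<close>, but between two ends of a positivity interval it would have to pass from a
  nonnegative to a nonpositive value (lemma \<open>maximum_principle\<close>). Because \<open>w\<close> satisfies Neumann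
  conditions, this works for Neumann data, where \<open>u' w - u w'\<close> vanishes at the ends, and also for any
  function that is nonpositive at the ends.

  Hence for \<open>0 \<le> \<sigma>\<^sub>2 \<le> \<sigma>\<^sub>1\<close> both \<open>u\<^sub>N \<le> 0\<close> and \<open>u\<^sub>D \<le> 0\<close>; and \<open>u\<^sub>N - u\<^sub>D\<close>, being \<open>u\<^sub>N \<le> 0\<close> at the ends,
  is nonpositive as well (lemma \<open>dirichlet_neumann_comparison\<close>). The second part follows by changing
  all signs.

  The analytic input is that an absolutely continuous function with nonnegative derivative almost
  everywhere is nondecreasing (lemma \<open>nonneg_deriv_ae_imp_le\<close>), which is proved by a gauge argument.\<close>

section \<open>Absolutely continuous functions\<close>

lemma AE_lebesgue_on_iff_negligible:
  assumes "S \<in> sets lebesgue"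
  shows "(AE t in lebesgue_on S. P t) \<longleftrightarrow> negligible {t \<in> S. \<not> P t}"
proof -
  have "(AE t in lebesgue_on S. P t) \<longleftrightarrow> (AE t in lebesgue. t \<in> S \<longrightarrow> P t)"
    using assms by (intro AE_restrict_space_iff) auto
  also have "\<dots> \<longleftrightarrow> negligible {t \<in> S. \<not> P t}"
    by (auto simp: eventually_ae_filter_negligible intro: negligible_subset)
  finally show ?thesis .
qed

lemma abs_cont_on_subset:
  assumes "abs_cont_on S f" "R \<subseteq> S"
  shows "abs_cont_on R f"
  using assms unfolding abs_cont_on_def by (meson order_trans)

lemma division_member_real:
  fixes D :: "real set set"
  assumes "D division_of S" "k \<in> D"
  obtains x y where "x \<le> y" "k = {x..y}" "Inf k = x" "Sup k = y"
proof -
  obtain x y where k: "k = cbox x y" using assms by blast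
  moreover have "k \<noteq> {}" using assms by blast
  ultimately show ?thesis using that[of x y] by auto
qed

text \<open>All closure properties below come from this one: a function whose increments are controlled by
  those of two absolutely continuous functions is itself absolutely continuous.\<close>

lemma abs_cont_on_dominated:
  assumes f: "abs_cont_on S f" and g: "abs_cont_on S g"
    and dom: "\<And>x y. x \<in> S \<Longrightarrow> y \<in> S \<Longrightarrow> \<bar>h y - h x\<bar> \<le> M * (\<bar>f y - f x\<bar> + \<bar>g y - g x\<bar>)"
  shows "abs_cont_on S h"
  unfolding abs_cont_on_def
proof (intro allI impI)
  fix \<epsilon> :: real assume "\<epsilon> > 0"
  define M' where "M' = \<bar>M\<bar> + 1"
  have M': "M' > 0" "M \<le> M'" by (auto simp: M'_def)
  have e: "\<epsilon> / (2 * M') > 0" using \<open>\<epsilon> > 0\<close> M' by simp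
  obtain d1 where d1: "d1 > 0" "\<And>D. D division_of \<Union>D \<Longrightarrow> \<Union>D \<subseteq> S \<Longrightarrow> (\<Sum>k\<in>D. Sup k - Inf k) < d1 \<Longrightarrow>
      (\<Sum>k\<in>D. \<bar>f (Sup k) - f (Inf k)\<bar>) < \<epsilon> / (2 * M')"
    using f e unfolding abs_cont_on_def by meson
  obtain d2 where d2: "d2 > 0" "\<And>D. D division_of \<Union>D \<Longrightarrow> \<Union>D \<subseteq> S \<Longrightarrow> (\<Sum>k\<in>D. Sup k - Inf k) < d2 \<Longrightarrow>
      (\<Sum>k\<in>D. \<bar>g (Sup k) - g (Inf k)\<bar>) < \<epsilon> / (2 * M')"
    using g e unfolding abs_cont_on_def by meson
  show "\<exists>\<delta>>0. \<forall>D. D division_of \<Union>D \<and> \<Union>D \<subseteq> S \<and> (\<Sum>k\<in>D. Sup k - Inf k) < \<delta> \<longrightarrow>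
        (\<Sum>k\<in>D. \<bar>h (Sup k) - h (Inf k)\<bar>) < \<epsilon>"
  proof (intro exI[of _ "min d1 d2"] conjI allI impI)
    show "min d1 d2 > 0" using d1 d2 by simp
    fix D assume D: "D division_of \<Union>D \<and> \<Union>D \<subseteq> S \<and> (\<Sum>k\<in>D. Sup k - Inf k) < min d1 d2"
    have "(\<Sum>k\<in>D. \<bar>h (Sup k) - h (Inf k)\<bar>)
        \<le> (\<Sum>k\<in>D. M' * (\<bar>f (Sup k) - f (Inf k)\<bar> + \<bar>g (Sup k) - g (Inf k)\<bar>))"
    proof (rule sum_mono)
      fix k assume k: "k \<in> D"
      obtain x y where xy: "x \<le> y" "k = {x..y}" "Inf k = x" "Sup k = y"
        using division_member_real[OF conjunct1[OF D] k] .
      have "k \<subseteq> S" using k D by blast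
      then have "x \<in> S" "y \<in> S" using xy by auto
      then have "\<bar>h y - h x\<bar> \<le> M * (\<bar>f y - f x\<bar> + \<bar>g y - g x\<bar>)" by (rule dom)
      also have "\<dots> \<le> M' * (\<bar>f y - f x\<bar> + \<bar>g y - g x\<bar>)"
        using M' by (intro mult_right_mono) auto
      finally show "\<bar>h (Sup k) - h (Inf k)\<bar> \<le> M' * (\<bar>f (Sup k) - f (Inf k)\<bar> + \<bar>g (Sup k) - g (Inf k)\<bar>)"
        using xy by simp
    qed
    also have "\<dots> = M' * ((\<Sum>k\<in>D. \<bar>f (Sup k) - f (Inf k)\<bar>) + (\<Sum>k\<in>D. \<bar>g (Sup k) - g (Inf k)\<bar>))"
      by (simp only: sum_distrib_left[symmetric] sum.distrib)
    also have "\<dots> < M' * (\<epsilon> / (2 * M') + \<epsilon> / (2 * M'))"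
      using M' D d1(2)[of D] d2(2)[of D] by (intro mult_strict_left_mono add_strict_mono) auto
    also have "\<dots> = \<epsilon>" using M' by simp
    finally show "(\<Sum>k\<in>D. \<bar>h (Sup k) - h (Inf k)\<bar>) < \<epsilon>" .
  qed
qed

lemma abs_cont_on_lincomb:
  assumes f: "abs_cont_on S f" "abs_cont_on S g"
  shows "abs_cont_on S (\<lambda>t. c * f t + d * g t)"
proof (rule abs_cont_on_dominated[OF f, of _ "\<bar>c\<bar> + \<bar>d\<bar>"])
  fix x y
  have "\<bar>c * f y + d * g y - (c * f x + d * g x)\<bar> = \<bar>c * (f y - f x) + d * (g y - g x)\<bar>"
    by (simp add: algebra_simps)
  also have "\<dots> \<le> \<bar>c\<bar> * \<bar>f y - f x\<bar> + \<bar>d\<bar> * \<bar>g y - g x\<bar>"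
    by (metis abs_mult abs_triangle_ineq)
  also have "\<dots> \<le> (\<bar>c\<bar> + \<bar>d\<bar>) * (\<bar>f y - f x\<bar> + \<bar>g y - g x\<bar>)"
    by (simp add: algebra_simps)
  finally show "\<bar>c * f y + d * g y - (c * f x + d * g x)\<bar> \<le> (\<bar>c\<bar> + \<bar>d\<bar>) * (\<bar>f y - f x\<bar> + \<bar>g y - g x\<bar>)" .
qed

lemma abs_cont_on_mult:
  assumes f: "abs_cont_on {a..b} f" "continuous_on {a..b} f"
    and g: "abs_cont_on {a..b} g" "continuous_on {a..b} g"
  shows "abs_cont_on {a..b} (\<lambda>t. f t * g t)"
proof -
  have bdd: "\<exists>B\<ge>0. \<forall>x\<in>{a..b}. \<bar>h x\<bar> \<le> B" if "continuous_on {a..b} h" for h :: "real \<Rightarrow> real"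
  proof -
    have "bounded (h ` {a..b})"
      using that by (intro compact_imp_bounded compact_continuous_image) auto
    then obtain B where "\<forall>x\<in>{a..b}. \<bar>h x\<bar> \<le> B" by (auto simp: bounded_iff)
    then show ?thesis by (intro exI[of _ "\<bar>B\<bar>"]) force
  qed
  obtain A where A: "A \<ge> 0" "\<And>x. x \<in> {a..b} \<Longrightarrow> \<bar>f x\<bar> \<le> A" using bdd[OF f(2)] by blast
  obtain B where B: "B \<ge> 0" "\<And>x. x \<in> {a..b} \<Longrightarrow> \<bar>g x\<bar> \<le> B" using bdd[OF g(2)] by blast
  show ?thesis
  proof (rule abs_cont_on_dominated[OF f(1) g(1), of _ "A + B"])
    fix x y assume xy: "x \<in> {a..b}" "y \<in> {a..b}"
    have "\<bar>f y * g y - f x * g x\<bar> = \<bar>(f y - f x) * g y + f x * (g y - g x)\<bar>"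
      by (simp add: algebra_simps)
    also have "\<dots> \<le> \<bar>f y - f x\<bar> * \<bar>g y\<bar> + \<bar>f x\<bar> * \<bar>g y - g x\<bar>"
      by (metis abs_mult abs_triangle_ineq)
    also have "\<dots> \<le> \<bar>f y - f x\<bar> * B + A * \<bar>g y - g x\<bar>"
      using A B xy by (intro add_mono mult_left_mono mult_right_mono) auto
    also have "\<dots> \<le> (A + B) * (\<bar>f y - f x\<bar> + \<bar>g y - g x\<bar>)"
      using A B by (simp add: algebra_simps)
    finally show "\<bar>f y * g y - f x * g x\<bar> \<le> (A + B) * (\<bar>f y - f x\<bar> + \<bar>g y - g x\<bar>)" .
  qed
qed

text \<open>By the mean value theorem such a function is Lipschitz, so its increments are dominated by those
  of the identity.\<close>

lemma C1_imp_abs_cont_on: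
  assumes der: "\<And>t. t \<in> {a..b} \<Longrightarrow> (u has_real_derivative v t) (at t within {a..b})"
    and v: "continuous_on {a..b} v"
  shows "abs_cont_on {a..b} u"
proof -
  have "bounded (v ` {a..b})"
    using v by (intro compact_imp_bounded compact_continuous_image) auto
  then obtain B where B: "\<forall>x\<in>{a..b}. \<bar>v x\<bar> \<le> B" by (auto simp: bounded_iff)
  have id: "abs_cont_on {a..b} (\<lambda>t. t)"
    unfolding abs_cont_on_def
  proof (intro allI impI)
    fix e :: real assume "e > 0"
    have *: "(\<Sum>k\<in>D. \<bar>Sup k - Inf k\<bar>) = (\<Sum>k\<in>D. Sup k - Inf k)" if "D division_of \<Union>D" for D :: "real set set"
      by (intro sum.cong refl) (use division_member_real[OF that] in force)
    show "\<exists>\<delta>>0. \<forall>D. D division_of \<Union>D \<and> \<Union>D \<subseteq> {a..b} \<and> (\<Sum>k\<in>D. Sup k - Inf k) < \<delta> \<longrightarrow>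
        (\<Sum>k\<in>D. \<bar>Sup k - Inf k\<bar>) < e"
      using \<open>e > 0\<close> * by (intro exI[of _ e]) auto
  qed
  show ?thesis
  proof (rule abs_cont_on_dominated[OF id id, of _ "B / 2"])
    fix x y assume "x \<in> {a..b}" "y \<in> {a..b}"
    then have "norm (u y - u x) \<le> B * norm (y - x)"
      using der B by (intro field_differentiable_bound[of "{a..b}" u v]) auto
    then show "\<bar>u y - u x\<bar> \<le> B / 2 * (\<bar>y - x\<bar> + \<bar>y - x\<bar>)" by simp
  qed
qed

text \<open>A reflection maps divisions to divisions of the same total length and exchanges the endpoints
  of each interval.\<close>

lemma abs_cont_on_reflect:
  fixes c :: real
  assumes f: "abs_cont_on S f"
  shows "abs_cont_on ((\<lambda>t. c - t) ` S) (\<lambda>t. f (c - t))"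
  unfolding abs_cont_on_def
proof (intro allI impI)
  fix \<epsilon> :: real assume "\<epsilon> > 0"
  then obtain \<delta> where \<delta>: "\<delta> > 0" "\<And>D. D division_of \<Union>D \<Longrightarrow> \<Union>D \<subseteq> S \<Longrightarrow> (\<Sum>k\<in>D. Sup k - Inf k) < \<delta> \<Longrightarrow>
      (\<Sum>k\<in>D. \<bar>f (Sup k) - f (Inf k)\<bar>) < \<epsilon>"
    using f unfolding abs_cont_on_def by meson
  let ?r = "\<lambda>t::real. c - t"
  have inj: "inj ((`) ?r)" by (simp add: inj_def inj_image_eq_iff)
  have rr: "?r ` ?r ` A = A" for A by (force simp: image_iff)
  show "\<exists>\<delta>>0. \<forall>D. D division_of \<Union>D \<and> \<Union>D \<subseteq> ?r ` S \<and> (\<Sum>k\<in>D. Sup k - Inf k) < \<delta> \<longrightarrow>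
        (\<Sum>k\<in>D. \<bar>f (c - Sup k) - f (c - Inf k)\<bar>) < \<epsilon>"
  proof (intro exI[of _ \<delta>] conjI allI impI \<delta>(1))
    fix D assume D: "D division_of \<Union>D \<and> \<Union>D \<subseteq> ?r ` S \<and> (\<Sum>k\<in>D. Sup k - Inf k) < \<delta>"
    define E where "E = (`) ?r ` D"
    have mem: "\<exists>x y. x \<le> y \<and> k = {x..y} \<and> ?r ` k = {c-y..c-x}" if "k \<in> D" for k
      using division_member_real[OF conjunct1[OF D] that] by (metis image_diff_atLeastAtMost)
    have "E division_of \<Union>E"
    proof (rule division_ofI)
      show "finite E" using D by (auto simp: E_def)
      show "k \<noteq> {}" "\<exists>a b. k = cbox a b" if "k \<in> E" for k
        using that mem by (fastforce simp: E_def)+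
      fix k1 k2 assume "k1 \<in> E" "k2 \<in> E" "k1 \<noteq> k2"
      then obtain l1 l2 where l: "l1 \<in> D" "l2 \<in> D" "l1 \<noteq> l2" "k1 = ?r ` l1" "k2 = ?r ` l2"
        by (auto simp: E_def)
      obtain x1 y1 x2 y2 where e: "l1 = {x1..y1}" "k1 = {c-y1..c-x1}" "l2 = {x2..y2}" "k2 = {c-y2..c-x2}"
        using mem l by metis
      have "interior l1 \<inter> interior l2 = {}" using D l by blast
      then have "{x1<..<y1} \<inter> {x2<..<y2} = {}" by (simp add: e)
      then show "interior k1 \<inter> interior k2 = {}"
        by (simp add: e disjoint_iff)
    qed auto
    moreover have "\<Union>E \<subseteq> S"
    proof -
      have "\<Union>E = ?r ` \<Union>D" by (auto simp: E_def)
      also have "\<dots> \<subseteq> ?r ` ?r ` S" using D by blast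
      finally show ?thesis by (simp add: rr)
    qed
    moreover
    have ends: "Sup (?r ` k) = c - Inf k \<and> Inf (?r ` k) = c - Sup k" if k: "k \<in> D" for k
    proof -
      obtain x y where "x \<le> y" "k = {x..y}" "?r ` k = {c-y..c-x}" using mem[OF k] by blast
      then show ?thesis by simp
    qed
    have inj': "inj_on ((`) ?r) D" using inj by (rule inj_on_subset) simp
    have "(\<Sum>k\<in>E. Sup k - Inf k) = (\<Sum>k\<in>D. Sup k - Inf k)"
      unfolding E_def by (simp add: sum.reindex[OF inj'] ends)
    moreover have "(\<Sum>k\<in>E. \<bar>f (Sup k) - f (Inf k)\<bar>) = (\<Sum>k\<in>D. \<bar>f (c - Sup k) - f (c - Inf k)\<bar>)"
      unfolding E_def by (simp add: sum.reindex[OF inj'] ends abs_minus_commute)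
    ultimately show "(\<Sum>k\<in>D. \<bar>f (c - Sup k) - f (c - Inf k)\<bar>) < \<epsilon>"
      using \<delta>(2)[of E] D by simp
  qed
qed

text \<open>Choose a gauge so that an interval tagged outside the exceptional set \<open>N\<close> loses at most a small
  multiple of its length (by differentiability at the tag), while all intervals tagged in \<open>N\<close> lie in
  an open set of small measure containing \<open>N\<close>. Along a fine tagged division the increments of \<open>f\<close>
  telescope; the first kind contributes a small loss because the total length is \<open>b - a\<close>, and the
  second kind contributes a small loss by absolute continuity.\<close>

lemma nonneg_deriv_ae_imp_le:
  fixes f :: "real \<Rightarrow> real"
  assumes ab: "a \<le> b" and ac: "abs_cont_on {a..b} f" and N: "negligible N"
    and der: "\<And>t. t \<in> {a..b} - N \<Longrightarrow> \<exists>w\<ge>0. (f has_real_derivative w) (at t within {a..b})"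
  shows "f a \<le> f b"
proof (rule field_le_epsilon)
  fix e :: real assume "e > 0"
  define e1 where "e1 = e / (2 * (b - a + 1))"
  have e1: "e1 > 0" using \<open>e > 0\<close> ab by (simp add: e1_def)
  have e1': "e1 * (b - a) \<le> e / 2" using \<open>e > 0\<close> ab by (simp add: e1_def field_simps)
  obtain \<delta> where \<delta>: "\<delta> > 0" "\<And>D. D division_of \<Union>D \<Longrightarrow> \<Union>D \<subseteq> {a..b} \<Longrightarrow> (\<Sum>k\<in>D. Sup k - Inf k) < \<delta> \<Longrightarrow>
      (\<Sum>k\<in>D. \<bar>f (Sup k) - f (Inf k)\<bar>) < e / 2"
    using ac half_gt_zero[OF \<open>e > 0\<close>] unfolding abs_cont_on_def by meson
  obtain U where U: "open U" "N \<subseteq> U" "U - N \<in> lmeasurable" "emeasure lebesgue (U - N) < ennreal \<delta>"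
    using sets_lebesgue_outer_open[OF negligible_imp_sets[OF N] \<delta>(1)] .
  have "U \<in> lmeasurable" using U N
    by (metis Diff_partition fmeasurable.Un negligible_imp_measurable)
  have "measure lebesgue U = measure lebesgue (U - N)"
    using N by (simp add: measure_Diff_null_set negligible_iff_null_sets \<open>U \<in> lmeasurable\<close> fmeasurableD)
  also have "\<dots> < \<delta>"
    using U(4) by (simp add: emeasure_eq_measure2[OF U(3)] ennreal_less_iff)
  finally have mU: "measure lebesgue U < \<delta>" .
  have "\<exists>d>0. \<forall>y\<in>{a..b}. \<bar>y - t\<bar> < d \<longrightarrow> (y \<ge> t \<longrightarrow> f y - f t \<ge> - e1 * (y - t)) \<and> (y \<le> t \<longrightarrow> f t - f y \<ge> - e1 * (t - y))"
    if t: "t \<in> {a..b} - N" for t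
  proof -
    obtain w where w: "w \<ge> 0" "(f has_real_derivative w) (at t within {a..b})" using der[OF t] by blast
    then obtain d where d: "d > 0" "\<And>y. y \<in> {a..b} \<Longrightarrow> \<bar>y - t\<bar> < d \<Longrightarrow> \<bar>f y - f t - w * (y - t)\<bar> \<le> e1 * \<bar>y - t\<bar>"
      using e1 unfolding has_field_derivative_def has_derivative_within_alt by auto
    show ?thesis
    proof (intro exI[of _ d] conjI ballI impI d(1))
      fix y assume y: "y \<in> {a..b}" "\<bar>y - t\<bar> < d"
      note dy = d(2)[OF y]
      show "f y - f t \<ge> - e1 * (y - t)" if "y \<ge> t"
        using dy mult_nonneg_nonneg[OF w(1), of "y - t"] that by (simp add: abs_le_iff)
      show "f t - f y \<ge> - e1 * (t - y)" if "y \<le> t"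
        using dy mult_nonneg_nonneg[OF w(1), of "t - y"] that by (simp add: abs_le_iff algebra_simps)
    qed
  qed
  then obtain d where d: "\<And>t. t \<in> {a..b} - N \<Longrightarrow> d t > 0"
      "\<And>t y. t \<in> {a..b} - N \<Longrightarrow> y \<in> {a..b} \<Longrightarrow> \<bar>y - t\<bar> < d t \<Longrightarrow>
        (y \<ge> t \<longrightarrow> f y - f t \<ge> - e1 * (y - t)) \<and> (y \<le> t \<longrightarrow> f t - f y \<ge> - e1 * (t - y))"
    by metis
  define g where "g t = (if t \<in> N then U else if t \<in> {a..b} then ball t (d t) else UNIV)" for t
  have "gauge g" using U(1,2) d(1) by (auto simp: gauge_def g_def)
  then obtain p where p: "p tagged_division_of {a..b}" "g fine p"
    using fine_division_exists_real by blast
  have K: "\<exists>u v. u \<le> x \<and> x \<le> v \<and> K = {u..v} \<and> a \<le> u \<and> v \<le> b \<and> K \<subseteq> g x \<and> Inf K = u \<and> Sup K = v" 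
    if xK: "(x, K) \<in> p" for x K
  proof -
    obtain u v where uv: "K = cbox u v" using p(1) xK by blast
    moreover have "x \<in> K" "K \<subseteq> {a..b}" using p(1) xK by blast+
    moreover have "K \<subseteq> g x" using p(2) xK by (auto simp: fine_def)
    ultimately show ?thesis by (intro exI[of _ u] exI[of _ v]) auto
  qed
  define \<phi> where "\<phi> K = f (Sup K) - f (Inf K)" for K
  define p1 where "p1 = {q \<in> p. fst q \<in> N}"
  have fin: "finite p" using p(1) by blast
  have "p tagged_partial_division_of {a..b}" using p(1) by (simp add: tagged_division_of_def)
  then have p1: "p1 tagged_partial_division_of {a..b}"
    by (rule tagged_partial_division_subset) (auto simp: p1_def)
  define D where "D = snd ` p1"
  have D: "D division_of \<Union>D" unfolding D_def by (rule partial_division_of_tagged_division[OF p1])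
  have "\<Union>D \<subseteq> U" using K by (fastforce simp: D_def p1_def g_def)
  moreover have "\<Union>D \<subseteq> {a..b}" using p1 unfolding tagged_partial_division_of_def D_def by fastforce
  ultimately have DU: "\<Union>D \<subseteq> U" "\<Union>D \<subseteq> {a..b}" by auto
  have small: "(\<Sum>k\<in>D. \<bar>\<phi> k\<bar>) < e / 2"
    unfolding \<phi>_def
  proof (rule \<delta>(2)[OF D DU(2)])
    have "(\<Sum>k\<in>D. Sup k - Inf k) = (\<Sum>k\<in>D. measure lebesgue k)"
      by (intro sum.cong refl) (use division_member_real[OF D] in force)
    also have "\<dots> = measure lebesgue (\<Union>D)" by (rule content_division[OF D])
    also have "\<dots> \<le> measure lebesgue U"
      using DU(1) lmeasurable_division[OF D] \<open>U \<in> lmeasurable\<close> by (intro measure_mono_fmeasurable) auto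
    finally show "(\<Sum>k\<in>D. Sup k - Inf k) < \<delta>" using mU by simp
  qed
  \<comment> \<open>Setting \<open>\<psi>\<close> to zero on intervals without interior lets a sum over tagged intervals be turned into
    a sum over the intervals themselves: only degenerate intervals can occur with two tags.\<close>
  define \<psi> where "\<psi> K = (if interior K = {} then 0 else \<bar>\<phi> K\<bar>)" for K
  have \<psi>: "\<psi> K = \<bar>\<phi> K\<bar>" if xK: "(x, K) \<in> p" for x K
  proof -
    obtain u v where "u \<le> v" "K = {u..v}" "Inf K = u" "Sup K = v" using K[OF xK] by force
    then show ?thesis by (cases "u < v") (auto simp: \<psi>_def \<phi>_def)
  qed
  have "(\<Sum>(x,k)\<in>p1. \<psi> k) = (\<Sum>k\<in>D. \<psi> k)"
    unfolding D_def
  proof (rule sum.over_tagged_division_lemma[of _ "\<Union>D"])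
    show "p1 tagged_division_of \<Union>D"
      using p1 unfolding tagged_division_of_def D_def tagged_partial_division_of_def 
      by (auto; fastforce)
  qed (auto simp: \<psi>_def)
  also have "\<dots> = (\<Sum>k\<in>D. \<bar>\<phi> k\<bar>)"
    by (intro sum.cong refl) (use \<psi> in \<open>auto simp: D_def p1_def\<close>)
  finally have s1: "(\<Sum>(x,k)\<in>p1. \<psi> k) < e / 2" using small by simp
  have "f a - f b = - (\<Sum>(x,k)\<in>p. \<phi> k)"
    using additive_tagged_division_1[OF ab p(1), of f] by (simp add: \<phi>_def)
  also have "\<dots> \<le> (\<Sum>(x,k)\<in>p. (if x \<in> N then \<psi> k else 0) + e1 * (Sup k - Inf k))"
    unfolding sum_negf[symmetric]
  proof (rule sum_mono, clarify)
    fix x k assume xk: "(x, k) \<in> p"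
    obtain u v where uv: "u \<le> x" "x \<le> v" "k = {u..v}" "a \<le> u" "v \<le> b" "k \<subseteq> g x" "Inf k = u" "Sup k = v"
      using K[OF xk] by blast
    show "- \<phi> k \<le> (if x \<in> N then \<psi> k else 0) + e1 * (Sup k - Inf k)"
    proof (cases "x \<in> N")
      case True
      have "0 \<le> e1 * (Sup k - Inf k)" using e1 uv by simp
      then show ?thesis using True \<psi>[OF xk] by simp
    next
      case False
      have x: "x \<in> {a..b} - N" using uv False by auto
      have "u \<in> k" "v \<in> k" using uv by simp_all
      then have "u \<in> ball x (d x)" "v \<in> ball x (d x)"
        using uv(6) x by (auto simp: g_def)
      then have "\<bar>u - x\<bar> < d x" "\<bar>v - x\<bar> < d x"
        by (simp_all add: dist_real_def abs_minus_commute)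
      then have "f v - f x \<ge> - e1 * (v - x)" "f x - f u \<ge> - e1 * (x - u)"
        using d(2)[OF x, of u] d(2)[OF x, of v] uv by auto
      then show ?thesis using False uv by (simp add: \<phi>_def algebra_simps)
    qed
  qed
  also have "\<dots> = (\<Sum>(x,k)\<in>p1. \<psi> k) + e1 * (\<Sum>(x,k)\<in>p. Sup k - Inf k)"
    unfolding p1_def using fin 
    by (simp add: split_def sum.distrib sum_distrib_left sum.If_cases Int_def)
  also have "(\<Sum>(x,k)\<in>p. Sup k - Inf k) = b - a"
    using additive_tagged_division_1[OF ab p(1), of "\<lambda>x. x"] .
  finally show "f a \<le> f b + e" using s1 e1' by simp
qed

section \<open>Operations on solutions\<close>

lemma is_solution_lincomb:
  assumes u: "is_solution L b \<sigma> u v" and w: "is_solution L b \<tau> w z"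
  shows "is_solution L b (\<lambda>t. c * \<sigma> t + d * \<tau> t) (\<lambda>t. c * u t + d * w t) (\<lambda>t. c * v t + d * z t)"
  unfolding is_solution_def
proof (intro conjI ballI)
  show "((\<lambda>t. c * u t + d * w t) has_real_derivative c * v t + d * z t) (at t within {0..L})"
    if "t \<in> {0..L}" for t
    using u w that unfolding is_solution_def by (auto intro!: derivative_intros DERIV_cmult)
  show "continuous_on {0..L} (\<lambda>t. c * v t + d * z t)"
    using u w unfolding is_solution_def by (auto intro!: continuous_intros)
  show "abs_cont_on {0..L} (\<lambda>t. c * v t + d * z t)"
    using u w unfolding is_solution_def by (auto intro!: abs_cont_on_lincomb)
  have "AE t in lebesgue_on {0..L}. \<exists>x. (v has_real_derivative x) (at t within {0..L}) \<and> x + b t * u t = \<sigma> t"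
    "AE t in lebesgue_on {0..L}. \<exists>x. (z has_real_derivative x) (at t within {0..L}) \<and> x + b t * w t = \<tau> t"
    using u w unfolding is_solution_def by auto
  then show "AE t in lebesgue_on {0..L}. \<exists>x. ((\<lambda>t. c * v t + d * z t) has_real_derivative x) (at t within {0..L}) \<and>
      x + b t * (c * u t + d * w t) = c * \<sigma> t + d * \<tau> t"
  proof eventually_elim
    case (elim t)
    then obtain x y where x: "(v has_real_derivative x) (at t within {0..L})" "x + b t * u t = \<sigma> t"
      and y: "(z has_real_derivative y) (at t within {0..L})" "y + b t * w t = \<tau> t" by blast
    show ?case
    proof (intro exI[of _ "c * x + d * y"] conjI DERIV_add DERIV_cmult x(1) y(1))
      show "c * x + d * y + b t * (c * u t + d * w t) = c * \<sigma> t + d * \<tau> t"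
        unfolding x(2)[symmetric] y(2)[symmetric] by (simp add: algebra_simps)
    qed
  qed
qed

lemma is_solution_restrict:
  assumes u: "is_solution L b \<sigma> u v" and M: "M \<le> L"
    and eq: "\<And>t. t \<in> {0..M} \<Longrightarrow> b' t = b t"
  shows "is_solution M b' \<sigma> u v"
proof -
  have sub: "{0..M} \<subseteq> {0..L}" using M by auto
  have "negligible {t \<in> {0..L}. \<not> (\<exists>x. (v has_real_derivative x) (at t within {0..L}) \<and> x + b t * u t = \<sigma> t)}"
    using u by (simp add: is_solution_def AE_lebesgue_on_iff_negligible)
  then have "negligible {t \<in> {0..M}. \<not> (\<exists>x. (v has_real_derivative x) (at t within {0..M}) \<and> x + b' t * u t = \<sigma> t)}"
  proof (rule negligible_subset)
    show "{t \<in> {0..M}. \<not> (\<exists>x. (v has_real_derivative x) (at t within {0..M}) \<and> x + b' t * u t = \<sigma> t)}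
      \<subseteq> {t \<in> {0..L}. \<not> (\<exists>x. (v has_real_derivative x) (at t within {0..L}) \<and> x + b t * u t = \<sigma> t)}"
      using sub eq DERIV_subset[OF _ sub] by auto
  qed
  moreover have "(u has_real_derivative v t) (at t within {0..M})" if "t \<in> {0..M}" for t
    using u that sub by (intro DERIV_subset[OF _ sub]) (auto simp: is_solution_def)
  moreover have "continuous_on {0..M} v" "abs_cont_on {0..M} v"
    using u sub unfolding is_solution_def by (blast intro: continuous_on_subset abs_cont_on_subset)+
  ultimately show ?thesis
    unfolding is_solution_def by (simp add: AE_lebesgue_on_iff_negligible)
qed

lemma is_solution_reflect:
  assumes u: "is_solution L b \<sigma> u v"
  shows "is_solution L (\<lambda>t. b (L - t)) (\<lambda>t. \<sigma> (L - t)) (\<lambda>t. u (L - t)) (\<lambda>t. - v (L - t))"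
proof -
  have im: "(\<lambda>t. L - t) ` {0..L} = {0..L}" by simp
  have der: "((\<lambda>t. h (L - t)) has_real_derivative - w) (at t within {0..L})"
    if "(h has_real_derivative w) (at (L - t) within {0..L})" for h w t
  proof -
    have "((\<lambda>t. L - t) has_real_derivative -1) (at t within {0..L})"
      by (auto intro!: derivative_eq_intros)
    then show ?thesis
      using DERIV_image_chain[of h w "\<lambda>t. L - t" t "{0..L}" "-1"] that im by (simp add: o_def)
  qed
  have neg: "abs_cont_on {0..L} (\<lambda>t. - v (L - t))"
  proof -
    have "abs_cont_on {0..L} (\<lambda>t. v (L - t))"
      using abs_cont_on_reflect[of "{0..L}" v L] u im by (simp add: is_solution_def)
    from abs_cont_on_lincomb[OF this this, of "-1" 0] show ?thesis by simp
  qed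
  let ?N = "{t \<in> {0..L}. \<not> (\<exists>x. (v has_real_derivative x) (at t within {0..L}) \<and> x + b t * u t = \<sigma> t)}"
  have "negligible ?N"
    using u by (simp add: is_solution_def AE_lebesgue_on_iff_negligible)
  then have "negligible ((\<lambda>t. L - t) ` ?N)"
    by (rule negligible_differentiable_image_negligible[rotated]) (auto intro!: derivative_intros)
  then have "negligible {t \<in> {0..L}. \<not> (\<exists>x. ((\<lambda>t. - v (L - t)) has_real_derivative x) (at t within {0..L})
      \<and> x + b (L - t) * u (L - t) = \<sigma> (L - t))}" (is "negligible ?R")
  proof (rule negligible_subset)
    show "?R \<subseteq> (\<lambda>t. L - t) ` ?N"
    proof
      fix t assume t: "t \<in> ?R"
      have "\<not> (\<exists>x. (v has_real_derivative x) (at (L - t) within {0..L}) \<and> x + b (L - t) * u (L - t) = \<sigma> (L - t))"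
        using t DERIV_minus[OF der] by fastforce
      then have "L - t \<in> ?N" using t by auto
      then show "t \<in> (\<lambda>t. L - t) ` ?N" by (intro image_eqI[of _ _ "L - t"]) simp_all
    qed
  qed
  moreover have "continuous_on {0..L} (\<lambda>t. - v (L - t))"
  proof -
    have "continuous_on {0..L} v" "continuous_on {0..L} (\<lambda>t. L - t)"
      using u by (simp_all add: is_solution_def continuous_on_diff)
    then have "continuous_on {0..L} (\<lambda>t. v (L - t))"
      by (rule continuous_on_compose2) simp
    then show ?thesis by (rule continuous_on_minus)
  qed
  moreover have "((\<lambda>t. u (L - t)) has_real_derivative - v (L - t)) (at t within {0..L})" if "t \<in> {0..L}" for t
    using u that by (intro der) (simp add: is_solution_def)
  ultimately show ?thesis
    using neg by (simp add: is_solution_def AE_lebesgue_on_iff_negligible)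
qed

section \<open>The maximum principle\<close>

text \<open>Walking left from a point where \<open>u\<close> is positive, one reaches either the end of the interval or
  a first zero of \<open>u\<close>; at such a zero \<open>u\<close> cannot be decreasing to the right.\<close>

lemma positive_component_left_end:
  fixes u v :: "real \<Rightarrow> real"
  assumes "a \<le> b" and der: "\<And>t. t \<in> {a..b} \<Longrightarrow> (u has_real_derivative v t) (at t within {a..b})"
    and pos: "u b > 0"
  obtains \<alpha> where "\<alpha> \<in> {a..b}" "\<And>t. t \<in> {\<alpha><..b} \<Longrightarrow> u t > 0"
    "\<alpha> = a \<and> u a > 0 \<or> \<alpha> < b \<and> u \<alpha> = 0 \<and> v \<alpha> \<ge> 0"
proof (cases "\<forall>t\<in>{a..b}. u t > 0")
  case True
  then show ?thesis using that[of a] \<open>a \<le> b\<close> by auto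
next
  case False
  have cont: "continuous_on {a..b} u" using der by (rule DERIV_continuous_on)
  define S where "S = {a..b} \<inter> u -` {..0}"
  have "closed S" unfolding S_def by (intro continuous_closed_preimage cont) auto
  moreover have "bounded S" by (rule bounded_subset[of "{a..b}"]) (auto simp: S_def)
  ultimately have "compact S" by (simp add: compact_eq_bounded_closed)
  moreover have "S \<noteq> {}" using False by (force simp: S_def)
  ultimately obtain \<alpha> where \<alpha>: "\<alpha> \<in> S" "\<And>t. t \<in> S \<Longrightarrow> t \<le> \<alpha>" using compact_attains_sup by metis
  have ab: "\<alpha> \<in> {a..b}" "u \<alpha> \<le> 0" using \<alpha> by (auto simp: S_def)
  then have "\<alpha> < b" using pos by (cases "\<alpha> = b") auto
  have upos: "u t > 0" if "t \<in> {\<alpha><..b}" for t using \<alpha>(2)[of t] that ab by (force simp: S_def)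
  have "\<exists>x. \<alpha> \<le> x \<and> x \<le> b \<and> u x = 0"
    using ab pos by (intro IVT' continuous_on_subset[OF cont]) auto
  then have "u \<alpha> = 0" using upos by (metis greaterThanAtMost_iff less_irrefl order_le_less)
  moreover have "v \<alpha> \<ge> 0"
  proof (rule ccontr)
    assume "\<not> v \<alpha> \<ge> 0"
    then obtain d where d: "d > 0" "\<And>h. h > 0 \<Longrightarrow> \<alpha> + h \<in> {a..b} \<Longrightarrow> h < d \<Longrightarrow> u \<alpha> > u (\<alpha> + h)"
      using has_real_derivative_neg_dec_right[OF der[OF ab(1)]] by auto
    define h where "h = min (d/2) (b - \<alpha>)"
    have "h > 0" "h < d" "\<alpha> + h \<in> {\<alpha><..b}" using d(1) \<open>\<alpha> < b\<close> by (auto simp: h_def)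
    then show False using d(2)[of h] upos[of "\<alpha> + h"] ab \<open>u \<alpha> = 0\<close> by auto
  qed
  ultimately show ?thesis using that[of \<alpha>] ab upos \<open>\<alpha> < b\<close> by blast
qed

text \<open>The mirror image, obtained by substituting \<open>-t\<close> for \<open>t\<close>.\<close>

lemma positive_component_right_end:
  fixes u v :: "real \<Rightarrow> real"
  assumes "a \<le> b" and der: "\<And>t. t \<in> {a..b} \<Longrightarrow> (u has_real_derivative v t) (at t within {a..b})"
    and pos: "u a > 0"
  obtains \<beta> where "\<beta> \<in> {a..b}" "\<And>t. t \<in> {a..<\<beta>} \<Longrightarrow> u t > 0"
    "\<beta> = b \<and> u b > 0 \<or> a < \<beta> \<and> u \<beta> = 0 \<and> v \<beta> \<le> 0"
proof -
  have der': "((\<lambda>t. u (- t)) has_real_derivative - v (- t)) (at t within {-b..-a})" if "t \<in> {-b..-a}" for t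
  proof -
    have "(u has_real_derivative v (- t)) (at (- t) within uminus ` {-b..-a})"
      using that by (simp add: der)
    then have "(u \<circ> uminus has_real_derivative v (- t) * -1) (at t within {-b..-a})"
      by (rule DERIV_image_chain) (auto intro!: derivative_eq_intros)
    then show ?thesis by (simp add: o_def)
  qed
  have "-b \<le> -a" "u (- (- a)) > 0" using assms by auto
  then obtain \<alpha> where \<alpha>: "\<alpha> \<in> {-b..-a}" "\<And>t. t \<in> {\<alpha><..-a} \<Longrightarrow> u (- t) > 0"
    "\<alpha> = -b \<and> u (- (- b)) > 0 \<or> \<alpha> < -a \<and> u (- \<alpha>) = 0 \<and> - v (- \<alpha>) \<ge> 0"
    using positive_component_left_end[of "-b" "-a" "\<lambda>t. u (- t)" "\<lambda>t. - v (- t)"] der' by blast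
  show ?thesis
  proof (rule that[of "-\<alpha>"])
    show "u t > 0" if "t \<in> {a..<-\<alpha>}" for t using \<alpha>(2)[of "-t"] that by auto
  qed (use \<alpha> in auto)
qed

text \<open>The function \<open>w\<close> is a positive strict supersolution. The Wronskian-type function
  \<open>W = u' w - u w'\<close> satisfies \<open>W' = \<sigma> w + c u\<close> almost everywhere, since the terms with the potential
  cancel; hence \<open>W' > 0\<close> almost everywhere where \<open>u > 0\<close>. On a maximal interval \<open>(\<alpha>, \<beta>)\<close> on which
  \<open>u > 0\<close>, an endpoint inside \<open>[0,L]\<close> where \<open>u\<close> vanishes gives \<open>W(\<alpha>) = u'(\<alpha>) w(\<alpha>) \<ge> 0\<close> or
  \<open>W(\<beta>) = u'(\<beta>) w(\<beta>) \<le> 0\<close>, and at \<open>0\<close> and \<open>L\<close> the same signs are provided by the boundary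
  hypotheses, which cover Neumann as well as Dirichlet data. So \<open>W\<close> would have to increase strictly
  from a nonnegative to a nonpositive value.\<close>

lemma maximum_principle:
  assumes L: "L > 0"
    and u: "is_solution L b \<sigma> u v" and \<sigma>: "AE t in lebesgue_on {0..L}. \<sigma> t \<ge> 0"
    and w: "is_solution L b (\<lambda>t. - c) w z" and c: "c > 0" and wpos: "\<And>t. t \<in> {0..L} \<Longrightarrow> w t > 0"
    and left: "u 0 > 0 \<Longrightarrow> u 0 * z 0 \<le> v 0 * w 0"
    and right: "u L > 0 \<Longrightarrow> v L * w L \<le> u L * z L"
    and t: "t \<in> {0..L}"
  shows "u t \<le> 0"
proof (rule ccontr)
  assume "\<not> u t \<le> 0"
  then have ut: "u t > 0" by simp
  note U = u[unfolded is_solution_def] and Wz = w[unfolded is_solution_def]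
  have du: "(u has_real_derivative v s) (at s within {0..L})"
    and dw: "(w has_real_derivative z s) (at s within {0..L})" if "s \<in> {0..L}" for s
    using U Wz that by auto
  obtain \<alpha> where \<alpha>: "\<alpha> \<in> {0..t}" "\<And>s. s \<in> {\<alpha><..t} \<Longrightarrow> u s > 0"
    "\<alpha> = 0 \<and> u 0 > 0 \<or> \<alpha> < t \<and> u \<alpha> = 0 \<and> v \<alpha> \<ge> 0"
  proof (rule positive_component_left_end[of 0 t u v])
    show "(u has_real_derivative v s) (at s within {0..t})" if "s \<in> {0..t}" for s
      using du[of s] that t by (auto intro: DERIV_subset)
  qed (use t ut in auto)
  obtain \<beta> where \<beta>: "\<beta> \<in> {t..L}" "\<And>s. s \<in> {t..<\<beta>} \<Longrightarrow> u s > 0"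
    "\<beta> = L \<and> u L > 0 \<or> t < \<beta> \<and> u \<beta> = 0 \<and> v \<beta> \<le> 0"
  proof (rule positive_component_right_end[of t L u v])
    show "(u has_real_derivative v s) (at s within {t..L})" if "s \<in> {t..L}" for s
      using du[of s] that t by (auto intro: DERIV_subset)
  qed (use t ut in auto)
  define W where "W s = v s * w s + (- 1) * (u s * z s)" for s
  have W\<alpha>: "W \<alpha> \<ge> 0"
    using \<alpha>(3)
  proof (elim disjE conjE)
    assume "u \<alpha> = 0" "v \<alpha> \<ge> 0"
    moreover have "w \<alpha> > 0" using \<alpha>(1) t by (intro wpos) auto
    ultimately show ?thesis by (simp add: W_def)
  qed (use left in \<open>simp add: W_def\<close>)
  have W\<beta>: "W \<beta> \<le> 0"
    using \<beta>(3)
  proof (elim disjE conjE)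
    assume "u \<beta> = 0" "v \<beta> \<le> 0"
    moreover have "w \<beta> > 0" using \<beta>(1) t by (intro wpos) auto
    ultimately show ?thesis by (simp add: W_def mult_nonpos_nonneg)
  qed (use right in \<open>simp add: W_def\<close>)
  have "\<alpha> < \<beta>" using \<alpha> \<beta> L by auto
  have sub: "{\<alpha>..\<beta>} \<subseteq> {0..L}" using \<alpha> \<beta> by auto
  have upos: "u s > 0" if "s \<in> {\<alpha><..<\<beta>}" for s
    using that \<alpha>(2)[of s] \<beta>(2)[of s] by (cases "s \<le> t") auto
  have W_AC: "abs_cont_on {0..L} W"
    unfolding W_def
    using U Wz du dw C1_imp_abs_cont_on[of 0 L u v] C1_imp_abs_cont_on[of 0 L w z]
      DERIV_continuous_on[of "{0..L}" u v] DERIV_continuous_on[of "{0..L}" w z]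
      abs_cont_on_lincomb[of "{0..L}" "\<lambda>s. v s * w s" "\<lambda>s. u s * z s" 1 "-1"]
    by (simp add: abs_cont_on_mult)
  have AE: "AE s in lebesgue_on {0..L}. \<exists>x\<ge>c * u s. (W has_real_derivative x) (at s within {0..L})"
  proof -
    have "AE s in lebesgue_on {0..L}. s \<in> {0..L}"
      by (rule AE_I2) simp
    moreover have "AE s in lebesgue_on {0..L}. \<exists>x. (v has_real_derivative x) (at s within {0..L}) \<and> x + b s * u s = \<sigma> s"
      "AE s in lebesgue_on {0..L}. \<exists>x. (z has_real_derivative x) (at s within {0..L}) \<and> x + b s * w s = - c"
      using U Wz by auto
    ultimately show ?thesis
      using \<sigma>
    proof eventually_elim
      case (elim s)
      then obtain x y where x: "(v has_real_derivative x) (at s within {0..L})" "x + b s * u s = \<sigma> s"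
        and y: "(z has_real_derivative y) (at s within {0..L})" "y + b s * w s = - c" by blast
      have "(W has_real_derivative (v s * z s + x * w s) + (- 1) * (u s * y + v s * z s)) (at s within {0..L})"
        unfolding W_def using elim(1) by (intro DERIV_add DERIV_cmult DERIV_mult' x y du dw)
      moreover have "(v s * z s + x * w s) + (- 1) * (u s * y + v s * z s) = \<sigma> s * w s + c * u s"
      proof -
        have xy: "x = \<sigma> s - b s * u s" "y = - c - b s * w s" using x y by auto
        show ?thesis unfolding xy by (simp add: algebra_simps)
      qed
      moreover have "\<sigma> s * w s \<ge> 0" using elim wpos[of s] by simp
      ultimately show ?case
        by (intro exI[of _ "\<sigma> s * w s + c * u s"]) auto
    qed
  qed
  \<comment> \<open>The endpoints join the exceptional set because \<open>u\<close> may vanish there.\<close>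
  define N where "N = {s \<in> {0..L}. \<not> (\<exists>x\<ge>c * u s. (W has_real_derivative x) (at s within {0..L}))} \<union> {\<alpha>, \<beta>}"
  have N: "negligible N" 
    using AE unfolding N_def by (simp add: AE_lebesgue_on_iff_negligible)
  have der: "\<exists>x>0. (W has_real_derivative x) (at s within {\<alpha>..\<beta>})" if sN: "s \<in> {\<alpha>..\<beta>} - N" for s
  proof -
    have "s \<in> {\<alpha><..<\<beta>}" "s \<in> {0..L}" using sN sub by (auto simp: N_def)
    then obtain x where "x \<ge> c * u s" "(W has_real_derivative x) (at s within {0..L})"
      using sN by (auto simp: N_def)
    moreover have "c * u s > 0" using c upos \<open>s \<in> {\<alpha><..<\<beta>}\<close> by simp
    ultimately show ?thesis using DERIV_subset[OF _ sub] by (intro exI[of _ x]) auto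
  qed
  have mono: "W p \<le> W q" if "\<alpha> \<le> p" "p \<le> q" "q \<le> \<beta>" for p q
  proof (rule nonneg_deriv_ae_imp_le[OF that(2) _ N])
    have pq: "{p..q} \<subseteq> {\<alpha>..\<beta>}" using that by auto
    show "abs_cont_on {p..q} W" using W_AC pq sub by (blast intro: abs_cont_on_subset)
    show "\<exists>x\<ge>0. (W has_real_derivative x) (at s within {p..q})" if "s \<in> {p..q} - N" for s
      using der[of s] that pq DERIV_subset[OF _ pq] by (metis Diff_iff less_imp_le subsetD)
  qed
  \<comment> \<open>Monotonicity and the end signs force \<open>W = 0\<close>, which contradicts its positive derivative at any
    single point outside \<open>N\<close>.\<close>
  have W0: "W s = 0" if "s \<in> {\<alpha>..\<beta>}" for s
    using mono[of \<alpha> s] mono[of s \<beta>] that W\<alpha> W\<beta> by auto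
  have "\<not> {\<alpha>..\<beta>} \<subseteq> N"
    using N \<open>\<alpha> < \<beta>\<close> negligible_subset negligible_interval(1)[of \<alpha> \<beta>] by (metis box_real(1,2) greaterThanLessThan_empty_iff not_le)
  then obtain s where s: "s \<in> {\<alpha>..\<beta>} - N" by blast
  obtain x where x: "x > 0" "(W has_real_derivative x) (at s within {\<alpha>..\<beta>})" using der[OF s] by blast
  obtain d where d: "d > 0" "\<And>h. h > 0 \<Longrightarrow> s + h \<in> {\<alpha>..\<beta>} \<Longrightarrow> h < d \<Longrightarrow> W s < W (s + h)"
    using has_real_derivative_pos_inc_right[OF x(2,1)] by blast
  have "s < \<beta>" using s by (auto simp: N_def order_le_less)
  define h where "h = min (d/2) (\<beta> - s)"
  have "h > 0" "h < d" "s + h \<in> {\<alpha>..\<beta>}" using d(1) \<open>s < \<beta>\<close> s by (auto simp: h_def)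
  then show False using d(2)[of h] W0[of s] W0[of "s + h"] s by simp
qed

section \<open>Comparison of the Neumann and Dirichlet problems\<close>

lemma integral_kernel_neg:
  fixes G :: "real \<Rightarrow> real \<Rightarrow> real"
  assumes "L > 0" and G: "continuous_on ({0..L} \<times> {0..L}) (\<lambda>(t, s). G t s)"
    and neg: "\<And>s. s \<in> {0..L} \<Longrightarrow> G t s < 0" and t: "t \<in> {0..L}"
  shows "(LINT s:{0..L}|lebesgue. G t s) < 0"
proof -
  have "continuous_on {0..L} (\<lambda>s. (t, s))"
    by (intro continuous_on_Pair continuous_on_const continuous_on_id)
  then have cont: "continuous_on {0..L} (G t)"
    using continuous_on_compose2[OF G, of "{0..L}" "\<lambda>s. (t, s)"] t by (simp add: image_subset_iff)
  have "(LINT s:{0..L}|lebesgue. G t s) = integral {0..L} (G t)"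
    using absolutely_integrable_continuous_real[OF cont] by (rule set_lebesgue_integral_eq_integral)
  also have "\<dots> < integral {0..L} (\<lambda>s. 0)"
    using assms cont by (intro integral_less_real) auto
  finally show ?thesis by simp
qed

text \<open>Integrating \<open>G\<close> against the constant \<open>1\<close> gives a negative periodic solution \<open>p\<close> of
  \<open>p'' + b p = 1\<close>, where \<open>b\<close> is the extended potential. Since \<open>b\<close> is symmetric about \<open>T\<close>, the
  reflected function \<open>p(2T - t)\<close> solves the same equation, so \<open>w(t) = - p(t) - p(2T - t)\<close> solves it
  with right-hand side \<open>-2\<close>. The derivative of \<open>w\<close> vanishes at \<open>T\<close> by symmetry, and at \<open>0\<close> by symmetry
  together with the periodicity of \<open>p'\<close>.\<close>

lemma neumann_supersolution:
  assumes T: "T > 0"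
    and G: "periodic_greens_function (2 * T) (even_extension T a) G"
    and neg: "\<forall>t\<in>{0..2 * T}. \<forall>s\<in>{0..2 * T}. G t s < 0"
  obtains w z where "is_solution T a (\<lambda>t. - 2) w z" "\<And>t. t \<in> {0..T} \<Longrightarrow> w t > 0" "z 0 = 0" "z T = 0"
proof -
  define p where "p t = (LINT s:{0..2*T}|lebesgue. G t s * 1)" for t
  have "(\<lambda>t. 1 :: real) absolutely_integrable_on {0..2*T}"
    by (intro absolutely_integrable_continuous_real continuous_intros)
  then have "periodic_solution (2*T) (even_extension T a) (\<lambda>t. 1) p"
    using G unfolding periodic_greens_function_def p_def by blast
  then obtain q where p: "is_solution (2*T) (even_extension T a) (\<lambda>t. 1) p q" and per: "q 0 = q (2*T)"
    unfolding periodic_solution_def by blast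
  have pneg: "p t < 0" if "t \<in> {0..2*T}" for t
    using integral_kernel_neg[of "2*T" G t] G T neg that by (simp add: p_def periodic_greens_function_def)
  have 1: "is_solution T a (\<lambda>t. 1) p q"
    using T by (intro is_solution_restrict[OF p]) (auto simp: even_extension_def)
  have 2: "is_solution T a (\<lambda>t. 1) (\<lambda>t. p (2*T - t)) (\<lambda>t. - q (2*T - t))"
    using T by (intro is_solution_restrict[OF is_solution_reflect[OF p]]) (auto simp: even_extension_def)
  show ?thesis
  proof (rule that)
    show "is_solution T a (\<lambda>t. - 2) (\<lambda>t. -1 * p t + -1 * p (2*T - t)) (\<lambda>t. -1 * q t + -1 * - q (2*T - t))"
      using is_solution_lincomb[OF 1 2, of "-1" "-1"] by simp
    show "-1 * p t + -1 * p (2*T - t) > 0" if "t \<in> {0..T}" for t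
      using pneg[of t] pneg[of "2*T - t"] that T by simp
  qed (use per in simp_all)
qed

text \<open>Three uses of the maximum principle with the Neumann supersolution \<open>w\<close>: for \<open>u\<^sub>N\<close>, where the
  Wronskian vanishes at both ends; for \<open>u\<^sub>D\<close>, which vanishes at both ends; and for \<open>u\<^sub>N - u\<^sub>D\<close>,
  which equals \<open>u\<^sub>N \<le> 0\<close> at both ends and has the right-hand side \<open>\<sigma>\<^sub>1 - \<sigma>\<^sub>2 \<ge> 0\<close>.\<close>

lemma dirichlet_neumann_comparison:
  assumes T: "T > 0"
    and w: "is_solution T a (\<lambda>t. - 2) w z" "\<And>t. t \<in> {0..T} \<Longrightarrow> w t > 0" "z 0 = 0" "z T = 0"
    and N: "neumann_solution T a \<sigma>\<^sub>1 u\<^sub>N" and D: "dirichlet_solution T a \<sigma>\<^sub>2 u\<^sub>D"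
    and \<sigma>: "AE t in lebesgue_on {0..T}. 0 \<le> \<sigma>\<^sub>2 t \<and> \<sigma>\<^sub>2 t \<le> \<sigma>\<^sub>1 t"
    and t: "t \<in> {0..T}"
  shows "u\<^sub>N t \<le> u\<^sub>D t \<and> u\<^sub>D t \<le> 0"
proof -
  have max: "u s \<le> 0" if u: "is_solution T a \<sigma> u v" "AE t in lebesgue_on {0..T}. \<sigma> t \<ge> 0"
    and bc: "u 0 > 0 \<Longrightarrow> v 0 \<ge> 0" "u T > 0 \<Longrightarrow> v T \<le> 0" and s: "s \<in> {0..T}" for \<sigma> u v s
  proof (rule maximum_principle[OF T u w(1) _ w(2) _ _ s])
    have "w 0 > 0" "w T > 0" using w(2) T by auto
    then show "u 0 > 0 \<Longrightarrow> u 0 * z 0 \<le> v 0 * w 0" "u T > 0 \<Longrightarrow> v T * w T \<le> u T * z T"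
      using bc w(3,4) by (simp_all add: mult_nonpos_nonneg)
  qed auto
  obtain v\<^sub>N where N: "is_solution T a \<sigma>\<^sub>1 u\<^sub>N v\<^sub>N" "v\<^sub>N 0 = 0" "v\<^sub>N T = 0"
    using N unfolding neumann_solution_def by blast
  obtain v\<^sub>D where D: "is_solution T a \<sigma>\<^sub>2 u\<^sub>D v\<^sub>D" "u\<^sub>D 0 = 0" "u\<^sub>D T = 0"
    using D unfolding dirichlet_solution_def by blast
  have "AE t in lebesgue_on {0..T}. \<sigma>\<^sub>1 t \<ge> 0" using \<sigma> by eventually_elim auto
  then have uN: "u\<^sub>N s \<le> 0" if "s \<in> {0..T}" for s
    using that N w by (intro max[of \<sigma>\<^sub>1 u\<^sub>N v\<^sub>N]) auto
  have "AE t in lebesgue_on {0..T}. \<sigma>\<^sub>2 t \<ge> 0" using \<sigma> by eventually_elim auto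
  then have uD: "u\<^sub>D t \<le> 0"
    using t D by (intro max[of \<sigma>\<^sub>2 u\<^sub>D v\<^sub>D]) auto
  have sol: "is_solution T a (\<lambda>t. 1 * \<sigma>\<^sub>1 t + -1 * \<sigma>\<^sub>2 t) (\<lambda>t. 1 * u\<^sub>N t + -1 * u\<^sub>D t) (\<lambda>t. 1 * v\<^sub>N t + -1 * v\<^sub>D t)"
    by (rule is_solution_lincomb[OF N(1) D(1)])
  have "AE t in lebesgue_on {0..T}. 1 * \<sigma>\<^sub>1 t + -1 * \<sigma>\<^sub>2 t \<ge> 0" using \<sigma> by eventually_elim auto
  from max[OF sol this] have "1 * u\<^sub>N t + -1 * u\<^sub>D t \<le> 0"
    using t uN[of 0] uN[of T] D T by force
  then show ?thesis using uD by simp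
qed

theorem theorem4p12:
  fixes T :: real and a \<sigma>\<^sub>1 \<sigma>\<^sub>2 u\<^sub>N u\<^sub>D :: "real \<Rightarrow> real" and G :: "real \<Rightarrow> real \<Rightarrow> real"
  assumes "T > 0"
    and "a absolutely_integrable_on {0..T}"
    and "periodic_nonresonant (2 * T) (even_extension T a)"
    and "periodic_greens_function (2 * T) (even_extension T a) G"
    and "\<forall>t\<in>{0..2 * T}. \<forall>s\<in>{0..2 * T}. G t s < 0"
    and "\<sigma>\<^sub>1 absolutely_integrable_on {0..T}"
    and "\<sigma>\<^sub>2 absolutely_integrable_on {0..T}"
    and "neumann_solution T a \<sigma>\<^sub>1 u\<^sub>N"
    and "dirichlet_solution T a \<sigma>\<^sub>2 u\<^sub>D"
  shows "((AE t in lebesgue_on {0..T}. 0 \<le> \<sigma>\<^sub>2 t \<and> \<sigma>\<^sub>2 t \<le> \<sigma>\<^sub>1 t) \<longrightarrow>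
            (\<forall>t\<in>{0..T}. u\<^sub>N t \<le> u\<^sub>D t \<and> u\<^sub>D t \<le> 0)) \<and>
         ((AE t in lebesgue_on {0..T}. 0 \<ge> \<sigma>\<^sub>2 t \<and> \<sigma>\<^sub>2 t \<ge> \<sigma>\<^sub>1 t) \<longrightarrow>
            (\<forall>t\<in>{0..T}. u\<^sub>N t \<ge> u\<^sub>D t \<and> u\<^sub>D t \<ge> 0))"
proof -
  obtain w z where w: "is_solution T a (\<lambda>t. - 2) w z" "\<And>t. t \<in> {0..T} \<Longrightarrow> w t > 0" "z 0 = 0" "z T = 0"
    using neumann_supersolution assms(1,4,5) by blast
  have neg: "is_solution T a (\<lambda>t. - \<sigma> t) (\<lambda>t. - u t) (\<lambda>t. - v t)" if "is_solution T a \<sigma> u v" for \<sigma> u v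
    using is_solution_lincomb[OF that that, of "-1" 0] by simp
  have N: "neumann_solution T a (\<lambda>t. - \<sigma>\<^sub>1 t) (\<lambda>t. - u\<^sub>N t)"
    using assms(8) neg unfolding neumann_solution_def by (metis minus_zero)
  have D: "dirichlet_solution T a (\<lambda>t. - \<sigma>\<^sub>2 t) (\<lambda>t. - u\<^sub>D t)"
    using assms(9) neg unfolding dirichlet_solution_def by (metis minus_zero)
  have "u\<^sub>N t \<ge> u\<^sub>D t \<and> u\<^sub>D t \<ge> 0"
    if "AE t in lebesgue_on {0..T}. 0 \<ge> \<sigma>\<^sub>2 t \<and> \<sigma>\<^sub>2 t \<ge> \<sigma>\<^sub>1 t" "t \<in> {0..T}" for t
    using dirichlet_neumann_comparison[OF assms(1) w N D _ that(2)] that(1) by simp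
  then show ?thesis
    using dirichlet_neumann_comparison[OF assms(1) w assms(8,9)] by blast
qed

end
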